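(* Let $k\geq1$. An element $\overrightarrow C\in V_k$ belongs to $X_k$ if and only if for every finite colouring $q$ of $\mathbb N^k$ there exists a finite word $w_q\in A^*$ such that $\langle\overrightarrow C,q\rangle=\langle w_q,q\rangle$. In particular, in that case, for any subset $Q\subseteq\mathbb N^k$ which is a union of colour classes of $q$ and every $\bar a\in A^k$, $C_{\bar a}\cap\widehat Q\neq\emptyset$ if and only if $c_{\bar a}(w_q)\cap Q\neq\emptyset$.
   Context: $A$ is a finite alphabet. For $\bar a\in A^k$, $w\in A^*$: $c_{\bar a}(w):=\{\bar i\in\mathbb N^k: i_j<|w|, w_{i_j}=a_j\ \forall j\}$. $\beta(\mathbb N^k)$ is the ultrafilter space with clopens $\widehat Q$; $V_k:=\mathcal V(\beta(\mathbb N^k))^{A^k}$ where $\mathcal V$ is the Vietoris hyperspace of closed subsets. $c^k:\beta(A^* )\to V_k$ is the continuous extension of $w\mapsto(\widehat{c_{\bar a}(w)})_{\bar a}$, and $X_k$ (the dual space of the Boolean algebra $\mathcal B_k$ generated by the languages $\{w: c_{\bar a}(w)\cap Q\neq\emptyset\}$) is identified with $c^k(\beta(A^* ))$, equivalently the closure of $c^k(A^* )$ in $V_k$. A finite colouring is a map $q:\mathbb N^k\to I$, $I$ finite. For $Q\subseteq\mathbb N^k$: $\langle w,Q\rangle:=\{\bar a: c_{\bar a}(w)\cap Q\neq\emptyset\}$ and, for $\overrightarrow C=(C_{\bar a})\in V_k$, $\langle\overrightarrow C,Q\rangle:=\{\bar a: C_{\bar a}\cap\widehat Q\neq\emptyset\}$;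 the profiles are $\langle w,q\rangle:=(\langle w,q^{-1}(i)\rangle)_{i\in I}$ and $\langle\overrightarrow C,q\rangle:=(\langle\overrightarrow C,q^{-1}(i)\rangle)_{i\in I}$. *)

theory Defs
  imports "HOL-Analysis.Analysis"
begin

definition ultrafilter_on :: "'s set \<Rightarrow> 's set set \<Rightarrow> bool" where
  "ultrafilter_on S U \<longleftrightarrow>
     U \<subseteq> Pow S \<and> S \<in> U \<and> {} \<notin> U \<and>
     (\<forall>P Q. P \<in> U \<and> P \<subseteq> Q \<and> Q \<subseteq> S \<longrightarrow> Q \<in> U) \<and>
     (\<forall>P\<in>U. \<forall>Q\<in>U. P \<inter> Q \<in> U) \<and>
     (\<forall>Q. Q \<subseteq> S \<longrightarrow> Q \<in> U \<or> S - Q \<in> U)"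

definition uf_hat :: "'s set \<Rightarrow> 's set \<Rightarrow> 's set set set" where
  "uf_hat S Q = {U. ultrafilter_on S U \<and> Q \<in> U}"

definition uf_space :: "'s set \<Rightarrow> 's set set topology" where
  "uf_space S = topology_generated_by {uf_hat S Q | Q. Q \<subseteq> S}"

definition principal_uf :: "'s set \<Rightarrow> 's \<Rightarrow> 's set set" where
  "principal_uf S s = {Q. Q \<subseteq> S \<and> s \<in> Q}"

text \<open>The points are all closed subsets, including the empty one.\<close>

definition vietoris :: "'x topology \<Rightarrow> 'x set topology" where
  "vietoris X = topology_generated_by
     ({{C. closedin X C \<and> C \<subseteq> U} | U. openin X U} \<union>
      {{C. closedin X C \<and> C \<inter> U \<noteq> {}} | U. openin X U})"

text \<open>The continuous extension to \<open>\<beta>(S)\<close> of a map \<open>f\<close> from the discrete set \<open>S\<close>, with \<open>S\<close>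
  embedded as the principal ultrafilters. It exists and is unique when \<open>Y\<close> is compact Hausdorff
  and \<open>f\<close> takes values in \<open>Y\<close>; \<open>extensional\<close> only fixes the value outside \<open>\<beta>(S)\<close>.\<close>

definition beta_extension :: "'s set \<Rightarrow> 'y topology \<Rightarrow> ('s \<Rightarrow> 'y) \<Rightarrow> 's set set \<Rightarrow> 'y" where
  "beta_extension S Y f = (THE g. g \<in> extensional (topspace (uf_space S)) \<and>
     continuous_map (uf_space S) Y g \<and> (\<forall>s\<in>S. g (principal_uf S s) = f s))"

definition tuples :: "'b set \<Rightarrow> nat \<Rightarrow> 'b list set" where
  "tuples B k = {x \<in> lists B. length x = k}"

abbreviation Nk :: "nat \<Rightarrow> nat list set" where
  "Nk k \<equiv> tuples UNIV k"

definition occ :: "nat \<Rightarrow> 'a list \<Rightarrow> 'a list \<Rightarrow> nat list set" where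
  "occ k a w = {i \<in> Nk k. \<forall>j<k. i ! j < length w \<and> w ! (i ! j) = a ! j}"

definition Vk :: "'a set \<Rightarrow> nat \<Rightarrow> ('a list \<Rightarrow> nat list set set set) topology" where
  "Vk A k = product_topology (\<lambda>_. vietoris (uf_space (Nk k))) (tuples A k)"

definition ck_word :: "'a set \<Rightarrow> nat \<Rightarrow> 'a list \<Rightarrow> 'a list \<Rightarrow> nat list set set set" where
  "ck_word A k w = (\<lambda>a\<in>tuples A k. uf_hat (Nk k) (occ k a w))"

definition ck :: "'a set \<Rightarrow> nat \<Rightarrow> 'a list set set \<Rightarrow> 'a list \<Rightarrow> nat list set set set" where
  "ck A k = beta_extension (lists A) (Vk A k) (ck_word A k)"

definition Xk :: "'a set \<Rightarrow> nat \<Rightarrow> ('a list \<Rightarrow> nat list set set set) set" where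
  "Xk A k = ck A k ` topspace (uf_space (lists A))"

text \<open>Every finite set of colours is in bijection with a finite subset of \<open>nat\<close>, so colours are
  taken in \<open>nat\<close>.\<close>

definition finite_colouring :: "nat \<Rightarrow> nat set \<Rightarrow> (nat list \<Rightarrow> nat) \<Rightarrow> bool" where
  "finite_colouring k I q \<longleftrightarrow> finite I \<and> q \<in> Nk k \<rightarrow> I"

definition colour_class :: "nat \<Rightarrow> (nat list \<Rightarrow> nat) \<Rightarrow> nat \<Rightarrow> nat list set" where
  "colour_class k q i = {x \<in> Nk k. q x = i}"

definition word_pairing :: "'a set \<Rightarrow> nat \<Rightarrow> 'a list \<Rightarrow> nat list set \<Rightarrow> 'a list set" where
  "word_pairing A k w Q = {a \<in> tuples A k. occ k a w \<inter> Q \<noteq> {}}"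

definition point_pairing ::
  "'a set \<Rightarrow> nat \<Rightarrow> ('a list \<Rightarrow> nat list set set set) \<Rightarrow> nat list set \<Rightarrow> 'a list set" where
  "point_pairing A k C Q = {a \<in> tuples A k. C a \<inter> uf_hat (Nk k) Q \<noteq> {}}"

definition word_profile ::
  "'a set \<Rightarrow> nat \<Rightarrow> nat set \<Rightarrow> 'a list \<Rightarrow> (nat list \<Rightarrow> nat) \<Rightarrow> nat \<Rightarrow> 'a list set" where
  "word_profile A k I w q = (\<lambda>i\<in>I. word_pairing A k w (colour_class k q i))"

definition point_profile ::
  "'a set \<Rightarrow> nat \<Rightarrow> nat set \<Rightarrow> ('a list \<Rightarrow> nat list set set set) \<Rightarrow> (nat list \<Rightarrow> nat) \<Rightarrow>
     nat \<Rightarrow> 'a list set" where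
  "point_profile A k I C q = (\<lambda>i\<in>I. point_pairing A k C (colour_class k q i))"

end

theory Submission
  imports Defs
begin

text \<open>
  The extension \<open>c\<^sup>k\<close> sends an ultrafilter \<open>U\<close> on words to the point \<open>C\<close> for which \<open>C\<^sub>a\<close> meets the
  clopen of \<open>Q\<close> exactly when \<open>U\<close> contains the language of those \<open>w\<close> for which \<open>c\<^sub>a(w)\<close> meets \<open>Q\<close>.
  A closed set of ultrafilters is determined by the clopens it meets, so \<open>C \<in> X\<^sub>k\<close> says that the
  languages of all words agreeing with \<open>C\<close> about a pair \<open>(a, Q)\<close> lie in a common ultrafilter, that
  is, have the finite intersection property. Finitely many sets \<open>Q\<close> are refined by one finite
  colouring, and finitely many pairs \<open>(a, Q)\<close> are therefore handled by one profile.
\<close>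

section \<open>Ultrafilters\<close>

text \<open>Zorn's lemma applies to the families between \<open>F\<close> and \<open>Pow S\<close>
  with the finite intersection property. A maximal one is an ultrafilter, because a set outside it
  must be incompatible with finitely many of its members.\<close>

lemma fip_extends_to_ultrafilter_on:
  assumes "F \<subseteq> Pow S" and fip: "\<And>G. finite G \<Longrightarrow> G \<subseteq> F \<Longrightarrow> S \<inter> \<Inter>G \<noteq> {}"
  obtains U where "ultrafilter_on S U" "F \<subseteq> U"
proof -
  \<comment> \<open>Intersecting with \<open>S\<close> gives the empty family \<open>G\<close> a
    meaning too: \<open>\<Inter>{}\<close> is \<open>UNIV\<close>, so the condition for it says that
    \<open>S\<close> is non-empty.\<close>
  define \<A> where "\<A> = {H. F \<subseteq> H \<and> H \<subseteq> Pow S \<and> (\<forall>G. finite G \<longrightarrow> G \<subseteq> H \<longrightarrow> S \<inter> \<Inter>G \<noteq> {})}"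
  have "F \<in> \<A>" using assms by (auto simp: \<A>_def)
  moreover have "\<Union>\<C> \<in> \<A>" if "\<C> \<noteq> {}" "subset.chain \<A> \<C>" for \<C>
  proof -
    have sub: "\<C> \<subseteq> \<A>" using that(2) by (simp add: subset.chain_def)
    have "S \<inter> \<Inter>G \<noteq> {}" if G: "finite G" "G \<subseteq> \<Union>\<C>" for G
    proof -
      obtain H where "H \<in> \<C>" "G \<subseteq> H"
        using finite_subset_Union_chain[OF G \<open>\<C> \<noteq> {}\<close> \<open>subset.chain \<A> \<C>\<close>] by blast
      moreover from this sub have "H \<in> \<A>" by blast
      ultimately show ?thesis using G(1) by (simp add: \<A>_def)
    qed
    moreover have "F \<subseteq> H \<and> H \<subseteq> Pow S" if "H \<in> \<C>" for H
      using sub that by (auto simp: \<A>_def)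
    hence "F \<subseteq> \<Union>\<C>" "\<Union>\<C> \<subseteq> Pow S" using \<open>\<C> \<noteq> {}\<close> by blast+
    ultimately show ?thesis by (simp add: \<A>_def)
  qed
  ultimately obtain M where M: "M \<in> \<A>" and max: "\<And>X. X \<in> \<A> \<Longrightarrow> M \<subseteq> X \<Longrightarrow> X = M"
    using subset_Zorn_nonempty[of \<A>] by (metis empty_iff)
  have MP: "M \<subseteq> Pow S" and FM: "F \<subseteq> M" using M by (auto simp: \<A>_def)
  have Mfip: "S \<inter> \<Inter>G \<noteq> {}" if "finite G" "G \<subseteq> M" for G
    using M that by (auto simp: \<A>_def)
  \<comment> \<open>By maximality \<open>insert Q M\<close> is not in \<open>\<A>\<close>, so some
    finite subfamily of it has empty intersection inside \<open>S\<close>; the members other than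
    \<open>Q\<close> form the witness.\<close>
  have witness: "\<exists>G. finite G \<and> G \<subseteq> M \<and> S \<inter> Q \<inter> \<Inter>G = {}" if "Q \<subseteq> S" "Q \<notin> M" for Q
  proof (rule ccontr)
    assume *: "\<not> ?thesis"
    have "S \<inter> \<Inter>G \<noteq> {}" if G: "finite G" "G \<subseteq> insert Q M" for G
    proof -
      have "S \<inter> Q \<inter> \<Inter>(G - {Q}) \<noteq> {}" using * G by (metis Diff_subset_conv finite_Diff insert_is_Un)
      thus ?thesis by blast
    qed
    moreover have "F \<subseteq> insert Q M" "insert Q M \<subseteq> Pow S" using FM MP \<open>Q \<subseteq> S\<close> by auto
    ultimately have "insert Q M \<in> \<A>" by (simp add: \<A>_def)
    from max[OF this] \<open>Q \<notin> M\<close> show False by blast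
  qed
  \<comment> \<open>If \<open>P\<close> were outside \<open>M\<close>, the finite family
    incompatible with \<open>P\<close>, joined to \<open>G\<close>, would have empty intersection.
    The closure properties of an ultrafilter follow by suitable choices of \<open>G\<close>.\<close>
  have mem: "P \<in> M" if "P \<subseteq> S" "finite G" "G \<subseteq> M" "S \<inter> \<Inter>G \<subseteq> P" for P G
  proof (rule ccontr)
    assume P: "P \<notin> M"
    obtain G' where G': "finite G'" "G' \<subseteq> M" "S \<inter> P \<inter> \<Inter>G' = {}"
      using witness[OF \<open>P \<subseteq> S\<close> P] by metis
    have "S \<inter> \<Inter>(G \<union> G') \<noteq> {}" using that(2,3) G'(1,2) by (intro Mfip) auto
    thus False using that(4) G'(3) by blast
  qed
  have "ultrafilter_on S M"
    unfolding ultrafilter_on_def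
  proof (intro conjI allI impI ballI)
    show "M \<subseteq> Pow S" by fact
    show "S \<in> M" using mem[of S "{}"] by simp
    show "{} \<notin> M" using Mfip[of "{{}}"] by auto
  next
    fix P Q assume "P \<in> M \<and> P \<subseteq> Q \<and> Q \<subseteq> S"
    thus "Q \<in> M" using mem[of Q "{P}"] by auto
  next
    fix P Q assume "P \<in> M" "Q \<in> M"
    thus "P \<inter> Q \<in> M" using mem[of "P \<inter> Q" "{P, Q}"] MP by auto
  next
    fix Q assume Q: "Q \<subseteq> S"
    show "Q \<in> M \<or> S - Q \<in> M"
    proof (cases "Q \<in> M")
      case False
      then obtain G where "finite G" "G \<subseteq> M" "S \<inter> Q \<inter> \<Inter>G = {}" using witness[OF Q] by metis
      hence "S - Q \<in> M" by (intro mem[of _ G]) auto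
      thus ?thesis ..
    qed simp
  qed
  thus thesis using FM that by blast
qed

text \<open>Closure under binary intersections puts every non-empty finite intersection back into
  \<open>F\<close>, where it cannot be empty; the empty subfamily is covered by
  \<open>S \<noteq> {}\<close>.\<close>

lemma filter_base_extends_to_ultrafilter_on:
  assumes "F \<subseteq> Pow S" "S \<noteq> {}" "{} \<notin> F" and int: "\<And>P Q. P \<in> F \<Longrightarrow> Q \<in> F \<Longrightarrow> P \<inter> Q \<in> F"
  obtains U where "ultrafilter_on S U" "F \<subseteq> U"
proof (rule fip_extends_to_ultrafilter_on[OF assms(1)])
  fix G assume G: "finite G" "G \<subseteq> F"
  show "S \<inter> \<Inter>G \<noteq> {}"
  proof (cases "G = {}")
    case False
    from G(1) this G(2) have "\<Inter>G \<in> F"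
      by (induction G rule: finite_ne_induct) (auto intro: int)
    thus ?thesis using assms(1,3) by (metis PowD inf.absorb_iff2 subsetD)
  qed (use \<open>S \<noteq> {}\<close> in simp)
qed (use that in blast)

context
  fixes S :: "'s set" and U
  assumes U: "ultrafilter_on S U"
begin

lemma ultrafilter_on_subset: "P \<in> U \<Longrightarrow> P \<subseteq> S"
  using U by (auto simp: ultrafilter_on_def)

lemma ultrafilter_on_carrier: "S \<in> U"
  using U by (auto simp: ultrafilter_on_def)

lemma ultrafilter_on_nonempty: "{} \<notin> U"
  using U by (auto simp: ultrafilter_on_def)

lemma ultrafilter_on_mono: "P \<in> U \<Longrightarrow> P \<subseteq> Q \<Longrightarrow> Q \<subseteq> S \<Longrightarrow> Q \<in> U"
  using U unfolding ultrafilter_on_def by blast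

lemma ultrafilter_on_Int: "P \<in> U \<Longrightarrow> Q \<in> U \<Longrightarrow> P \<inter> Q \<in> U"
  using U unfolding ultrafilter_on_def by blast

lemma ultrafilter_on_Compl_iff:
  assumes "Q \<subseteq> S" shows "S - Q \<in> U \<longleftrightarrow> Q \<notin> U"
proof
  assume "S - Q \<in> U"
  thus "Q \<notin> U"
    using ultrafilter_on_Int[of Q "S - Q"] ultrafilter_on_nonempty by auto
next
  assume "Q \<notin> U"
  thus "S - Q \<in> U" using U assms unfolding ultrafilter_on_def by blast
qed

lemma ultrafilter_on_Un_iff:
  assumes "P \<subseteq> S" "Q \<subseteq> S" shows "P \<union> Q \<in> U \<longleftrightarrow> P \<in> U \<or> Q \<in> U"
proof
  assume PQ: "P \<union> Q \<in> U"
  show "P \<in> U \<or> Q \<in> U"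
  proof (rule ccontr)
    assume "\<not> ?thesis"
    hence "(S - P) \<inter> (S - Q) \<in> U" using assms by (simp add: ultrafilter_on_Compl_iff ultrafilter_on_Int)
    from ultrafilter_on_Int[OF this PQ] have "(S - P) \<inter> (S - Q) \<inter> (P \<union> Q) \<in> U" .
    moreover have "(S - P) \<inter> (S - Q) \<inter> (P \<union> Q) = {}" by blast
    ultimately show False using ultrafilter_on_nonempty by simp
  qed
next
  assume "P \<in> U \<or> Q \<in> U"
  thus "P \<union> Q \<in> U" using assms ultrafilter_on_mono[of P "P \<union> Q"] ultrafilter_on_mono[of Q "P \<union> Q"]
    by auto
qed

lemma ultrafilter_on_UN_iff:
  assumes "finite J" "\<And>i. i \<in> J \<Longrightarrow> P i \<subseteq> S"
  shows "(\<Union>i\<in>J. P i) \<in> U \<longleftrightarrow> (\<exists>i\<in>J. P i \<in> U)"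
  using assms
proof (induction J rule: finite_induct)
  case empty
  thus ?case using ultrafilter_on_nonempty by simp
next
  case (insert i J)
  have "(\<Union>i\<in>J. P i) \<subseteq> S" using insert.prems by blast
  thus ?case using insert by (simp add: ultrafilter_on_Un_iff)
qed

lemma ultrafilter_on_INT:
  assumes "finite J" "\<And>i. i \<in> J \<Longrightarrow> P i \<in> U"
  shows "S \<inter> (\<Inter>i\<in>J. P i) \<in> U"
  using assms
proof (induction J rule: finite_induct)
  case empty
  thus ?case using ultrafilter_on_carrier by simp
next
  case (insert i J)
  have "S \<inter> (\<Inter>i\<in>insert i J. P i) = P i \<inter> (S \<inter> (\<Inter>i\<in>J. P i))" by blast
  thus ?case using insert by (simp add: ultrafilter_on_Int)
qed

end

lemma principal_ultrafilter_on: "s \<in> S \<Longrightarrow> ultrafilter_on S (principal_uf S s)"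
  unfolding ultrafilter_on_def principal_uf_def by auto

text \<open>A form of the prime ideal theorem: the sets without \<open>G\<close> form an ideal, and
  \<open>V\<close> has to contain \<open>Q\<close> and avoid this ideal. The differences of
  \<open>Q\<close> with members of the ideal are closed under intersection by \<open>prime\<close>
  and non-empty by \<open>mono\<close>, so they extend to an ultrafilter.\<close>

lemma grill_contains_ultrafilter_on:
  assumes "Q \<subseteq> S" "G Q" "\<not> G {}"
    and mono: "\<And>P R. G P \<Longrightarrow> P \<subseteq> R \<Longrightarrow> R \<subseteq> S \<Longrightarrow> G R"
    and prime: "\<And>P R. P \<subseteq> S \<Longrightarrow> R \<subseteq> S \<Longrightarrow> G (P \<union> R) \<Longrightarrow> G P \<or> G R"
  obtains V where "ultrafilter_on S V" "Q \<in> V" "\<And>P. P \<in> V \<Longrightarrow> G P"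
proof -
  define F where "F = {Q - P | P. P \<subseteq> S \<and> \<not> G P}"
  have "Q \<noteq> {}" using assms by blast
  obtain V where V: "ultrafilter_on S V" "F \<subseteq> V"
  proof (rule filter_base_extends_to_ultrafilter_on)
    show "F \<subseteq> Pow S" using \<open>Q \<subseteq> S\<close> by (auto simp: F_def)
    show "S \<noteq> {}" using \<open>Q \<noteq> {}\<close> \<open>Q \<subseteq> S\<close> by blast
    show "{} \<notin> F" using mono[OF \<open>G Q\<close>] unfolding F_def by blast
    fix P R assume "P \<in> F" "R \<in> F"
    then obtain P' R' where *: "P = Q - P'" "R = Q - R'" "P' \<subseteq> S" "R' \<subseteq> S" "\<not> G P'" "\<not> G R'"
      by (auto simp: F_def)
    hence "\<not> G (P' \<union> R')" "P \<inter> R = Q - (P' \<union> R')" using prime[of P' R'] by auto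
    thus "P \<inter> R \<in> F" using * unfolding F_def by blast
  qed
  show thesis
  proof
    show "ultrafilter_on S V" by fact
    \<comment> \<open>The empty set lies in the ideal, so \<open>Q\<close> itself is one of the
      differences.\<close>
    have "Q - {} \<in> F" using \<open>\<not> G {}\<close> unfolding F_def by blast
    thus "Q \<in> V" using V by auto
    fix P assume P: "P \<in> V"
    show "G P"
    proof (rule ccontr)
      assume "\<not> G P"
      hence "Q - P \<in> V" using V ultrafilter_on_subset[OF V(1) P] unfolding F_def by blast
      from ultrafilter_on_Int[OF V(1) this P] ultrafilter_on_nonempty[OF V(1)] show False
        by (simp add: Int_commute)
    qed
  qed
qed

section \<open>The ultrafilter space\<close>

lemma openin_uf_hat: "Q \<subseteq> S \<Longrightarrow> openin (uf_space S) (uf_hat S Q)"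
  unfolding uf_space_def by (rule topology_generated_by_Basis) blast

lemma topspace_uf_space: "topspace (uf_space S) = {U. ultrafilter_on S U}"
proof -
  have "topspace (uf_space S) = (\<Union>Q\<in>Pow S. uf_hat S Q)"
    unfolding uf_space_def topology_generated_by_topspace by blast
  also have "\<dots> = {U. ultrafilter_on S U}"
    by (auto simp: uf_hat_def ultrafilter_on_def)
  finally show ?thesis .
qed

text \<open>The generating clopens are closed under binary intersection, so they form a base and not
  merely a subbase. The forward direction is an induction over the generation of the open
  set.\<close>

lemma openin_uf_space_iff:
  "openin (uf_space S) W \<longleftrightarrow>
     (\<forall>U\<in>W. ultrafilter_on S U \<and> (\<exists>Q\<in>U. uf_hat S Q \<subseteq> W))" (is "?L \<longleftrightarrow> ?R")
proof
  assume ?L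
  hence "generate_topology_on {uf_hat S Q | Q. Q \<subseteq> S} W"
    by (simp add: uf_space_def openin_topology_generated_by_iff)
  thus ?R
  proof (induction rule: generate_topology_on.induct)
    case (Int a b)
    show ?case
    proof
      fix U assume U: "U \<in> a \<inter> b"
      then obtain P Q where PQ: "ultrafilter_on S U" "P \<in> U" "Q \<in> U" "uf_hat S P \<subseteq> a" "uf_hat S Q \<subseteq> b"
        using Int.IH by blast
      have "uf_hat S (P \<inter> Q) \<subseteq> uf_hat S P \<inter> uf_hat S Q"
        using ultrafilter_on_subset[OF PQ(1)] PQ(2,3)
        by (auto simp: uf_hat_def elim!: ultrafilter_on_mono)
      moreover have "P \<inter> Q \<in> U" using PQ by (simp add: ultrafilter_on_Int)
      ultimately show "ultrafilter_on S U \<and> (\<exists>Q\<in>U. uf_hat S Q \<subseteq> a \<inter> b)" using PQ by blast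
    qed
  next
    case (UN K)
    show ?case
    proof
      fix U assume "U \<in> \<Union>K"
      then obtain W where "W \<in> K" "U \<in> W" by blast
      with UN.IH[of W] show "ultrafilter_on S U \<and> (\<exists>Q\<in>U. uf_hat S Q \<subseteq> \<Union>K)" by blast
    qed
  qed (auto simp: uf_hat_def)
next
  assume R: ?R
  show ?L
  proof (subst openin_subopen, intro ballI)
    fix U assume "U \<in> W"
    then obtain Q where "ultrafilter_on S U" "Q \<in> U" "uf_hat S Q \<subseteq> W" using R by blast
    thus "\<exists>T. openin (uf_space S) T \<and> U \<in> T \<and> T \<subseteq> W"
      using openin_uf_hat[OF ultrafilter_on_subset] by (intro exI[of _ "uf_hat S Q"]) (auto simp: uf_hat_def)
  qed
qed

lemma topspace_diff_uf_hat:
  "Q \<subseteq> S \<Longrightarrow> topspace (uf_space S) - uf_hat S Q = uf_hat S (S - Q)"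
  by (auto simp: topspace_uf_space uf_hat_def ultrafilter_on_Compl_iff)

lemma closedin_uf_hat: "Q \<subseteq> S \<Longrightarrow> closedin (uf_space S) (uf_hat S Q)"
  using topspace_diff_uf_hat[of "S - Q" S] openin_uf_hat[of "S - Q" S]
  by (metis Diff_subset closedin_diff closedin_topspace double_diff order_refl)

lemma subset_uf_hat_iff:
  assumes "closedin (uf_space S) C" "Q \<subseteq> S"
  shows "C \<subseteq> uf_hat S Q \<longleftrightarrow> C \<inter> uf_hat S (S - Q) = {}"
  using closedin_subset[OF assms(1)] topspace_diff_uf_hat[OF assms(2)] by blast

text \<open>The clopens of the members of \<open>U\<close> are a neighbourhood base at
  \<open>U\<close>, so the right-hand side says that \<open>U\<close> lies in the closure of
  \<open>C\<close>.\<close>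

lemma mem_closedin_uf_space_iff:
  assumes C: "closedin (uf_space S) C" and U: "ultrafilter_on S U"
  shows "U \<in> C \<longleftrightarrow> (\<forall>Q\<in>U. C \<inter> uf_hat S Q \<noteq> {})"
proof
  assume "U \<in> C"
  thus "\<forall>Q\<in>U. C \<inter> uf_hat S Q \<noteq> {}" using U by (auto simp: uf_hat_def)
next
  assume *: "\<forall>Q\<in>U. C \<inter> uf_hat S Q \<noteq> {}"
  show "U \<in> C"
  proof (rule ccontr)
    assume "U \<notin> C"
    hence "U \<in> topspace (uf_space S) - C" using U by (simp add: topspace_uf_space)
    moreover have "openin (uf_space S) (topspace (uf_space S) - C)" using C by blast
    ultimately obtain Q where "Q \<in> U" "uf_hat S Q \<subseteq> topspace (uf_space S) - C"
      unfolding openin_uf_space_iff by blast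
    with * show False by blast
  qed
qed

text \<open>The clopens that a closed set meets decide which ultrafilters belong to it. This is how
  closed sets are compared from here on.\<close>

lemma closedin_uf_space_eqI:
  assumes "closedin (uf_space S) C" "closedin (uf_space S) D"
    and "\<And>Q. Q \<subseteq> S \<Longrightarrow> C \<inter> uf_hat S Q \<noteq> {} \<longleftrightarrow> D \<inter> uf_hat S Q \<noteq> {}"
  shows "C = D"
proof -
  have "U \<in> C \<longleftrightarrow> U \<in> D" if "ultrafilter_on S U" for U
    using assms that by (simp add: mem_closedin_uf_space_iff ultrafilter_on_subset)
  moreover have "C \<subseteq> {U. ultrafilter_on S U}" "D \<subseteq> {U. ultrafilter_on S U}"
    using assms closedin_subset by (fastforce simp: topspace_uf_space)+
  ultimately show ?thesis by blast
qed

text \<open>This is the form in which compactness of the ultrafilter space is used.\<close>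

lemma clopen_between_closedin_openin:
  assumes C: "closedin (uf_space S) C" and W: "openin (uf_space S) W" and "C \<subseteq> W"
  obtains Q where "Q \<subseteq> S" "C \<subseteq> uf_hat S Q" "uf_hat S Q \<subseteq> W"
proof (rule ccontr)
  note ex = that
  assume no_thesis: "\<not> thesis"
  have no: False if "Q \<subseteq> S" "C \<subseteq> uf_hat S Q" "uf_hat S Q \<subseteq> W" for Q
    using no_thesis ex[OF that] by blast
  \<comment> \<open>If no clopen lies between \<open>C\<close> and \<open>W\<close>, then no
    difference in \<open>F\<close> is empty, since \<open>P \<subseteq> Q\<close> would make
    \<open>uf_hat S Q\<close> such a clopen. An ultrafilter containing \<open>F\<close> will then be
    in \<open>C\<close> but not in \<open>W\<close>.\<close>
  define F where "F = {P - Q | P Q. P \<subseteq> S \<and> Q \<subseteq> S \<and> C \<subseteq> uf_hat S P \<and> uf_hat S Q \<subseteq> W}"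
  have Cuf: "C \<subseteq> {U. ultrafilter_on S U}"
    using closedin_subset[OF C] by (simp add: topspace_uf_space)
  have hat_empty: "uf_hat S {} = {}" by (auto simp: uf_hat_def ultrafilter_on_def)
  have hat_S: "uf_hat S S = {U. ultrafilter_on S U}" by (auto simp: uf_hat_def ultrafilter_on_def)
  obtain U where U: "ultrafilter_on S U" "F \<subseteq> U"
  proof (rule filter_base_extends_to_ultrafilter_on)
    show "F \<subseteq> Pow S" by (auto simp: F_def)
    show "{} \<notin> F"
    proof
      assume "{} \<in> F"
      then obtain P Q where PQ: "P \<subseteq> Q" "Q \<subseteq> S" "C \<subseteq> uf_hat S P" "uf_hat S Q \<subseteq> W"
        by (auto simp: F_def)
      have "uf_hat S P \<subseteq> uf_hat S Q" using PQ by (auto simp: uf_hat_def elim: ultrafilter_on_mono)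
      thus False using no PQ by blast
    qed
    show "S \<noteq> {}"
    proof
      assume "S = {}"
      hence "C \<subseteq> uf_hat S {}" "uf_hat S {} \<subseteq> W" using Cuf hat_S hat_empty by auto
      thus False using no by blast
    qed
    fix X Y assume "X \<in> F" "Y \<in> F"
    then obtain P Q P' Q' where *: "X = P - Q" "Y = P' - Q'" "P \<subseteq> S" "Q \<subseteq> S" "P' \<subseteq> S" "Q' \<subseteq> S"
      "C \<subseteq> uf_hat S P" "C \<subseteq> uf_hat S P'" "uf_hat S Q \<subseteq> W" "uf_hat S Q' \<subseteq> W"
      by (auto simp: F_def)
    have "X \<inter> Y = (P \<inter> P') - (Q \<union> Q')" using * by blast
    moreover have "C \<subseteq> uf_hat S (P \<inter> P')" using *(7,8)
      by (auto simp: uf_hat_def intro: ultrafilter_on_Int)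
    moreover have "uf_hat S (Q \<union> Q') \<subseteq> W" using *(4,6,9,10)
      by (auto simp: uf_hat_def ultrafilter_on_Un_iff)
    moreover have "P \<inter> P' \<subseteq> S" "Q \<union> Q' \<subseteq> S" using * by auto
    ultimately show "X \<inter> Y \<in> F" unfolding F_def by blast
  qed
  \<comment> \<open>The members of \<open>F\<close> from which nothing is subtracted force
    \<open>U \<in> C\<close>: if \<open>C\<close> missed the clopen of \<open>Q\<close>, then
    \<open>U\<close> would contain both \<open>Q\<close> and \<open>S - Q\<close>.\<close>
  have "C \<inter> uf_hat S Q \<noteq> {}" if "Q \<in> U" for Q
  proof
    assume "C \<inter> uf_hat S Q = {}"
    moreover have Q: "Q \<subseteq> S" using U(1) that by (rule ultrafilter_on_subset)
    ultimately have "C \<subseteq> uf_hat S (S - Q)" using subset_uf_hat_iff[OF C, of "S - Q"]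
      by (simp add: double_diff)
    hence "(S - Q) - {} \<in> F" using hat_empty unfolding F_def by blast
    thus False using U that Q ultrafilter_on_Compl_iff[OF U(1) Q] by auto
  qed
  hence "U \<in> W" using \<open>C \<subseteq> W\<close> mem_closedin_uf_space_iff[OF C U(1)] by blast
  then obtain Q where Q: "Q \<in> U" "uf_hat S Q \<subseteq> W" using W unfolding openin_uf_space_iff by blast
  have "Q \<subseteq> S" using U(1) Q(1) by (rule ultrafilter_on_subset)
  moreover have "C \<subseteq> uf_hat S S" using Cuf by (simp only: hat_S)
  \<comment> \<open>With \<open>S\<close> as the set whose clopen includes \<open>C\<close>, the
    family \<open>F\<close> also keeps \<open>U\<close> out of \<open>W\<close>.\<close>
  ultimately have "S - Q \<in> F" using Q(2) unfolding F_def by blast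
  thus False using U Q(1) ultrafilter_on_Compl_iff[OF U(1) \<open>Q \<subseteq> S\<close>] by auto
qed

text \<open>Members of an ultrafilter are non-empty, so each basic neighbourhood contains the
  principal ultrafilter of some point. Density is what makes continuous extensions unique.\<close>

lemma principal_ufs_dense:
  "uf_space S closure_of (principal_uf S ` S) = topspace (uf_space S)"
proof (rule antisym[OF closure_of_subset_topspace subsetI])
  fix U assume U: "U \<in> topspace (uf_space S)"
  show "U \<in> uf_space S closure_of (principal_uf S ` S)"
    unfolding in_closure_of
  proof (intro conjI allI impI U)
    fix T assume T: "U \<in> T \<and> openin (uf_space S) T"
    then obtain Q where Q: "ultrafilter_on S U" "Q \<in> U" "uf_hat S Q \<subseteq> T"
      unfolding openin_uf_space_iff by blast
    then obtain s where s: "s \<in> Q" using ultrafilter_on_nonempty by (metis ex_in_conv)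
    have QS: "Q \<subseteq> S" using Q by (simp add: ultrafilter_on_subset)
    hence "principal_uf S s \<in> uf_hat S Q" using s principal_ultrafilter_on[of s S]
      by (auto simp: uf_hat_def principal_uf_def)
    thus "\<exists>y. y \<in> principal_uf S ` S \<and> y \<in> T" using Q s QS by blast
  qed
qed

text \<open>This resolves the \<open>THE\<close> in \<open>beta_extension\<close>: existence is
  witnessed by \<open>g\<close>, and continuous maps into a Hausdorff space that agree on the dense
  set of principal ultrafilters are equal. Restriction makes the witness
  \<open>extensional\<close>.\<close>

lemma beta_extension_eqI:
  assumes Y: "Hausdorff_space Y" and g: "continuous_map (uf_space S) Y g"
    and ext: "\<And>s. s \<in> S \<Longrightarrow> g (principal_uf S s) = f s" and U: "ultrafilter_on S U"
  shows "beta_extension S Y f U = g U"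
proof -
  let ?X = "topspace (uf_space S)"
  have uf: "principal_uf S s \<in> ?X" if "s \<in> S" for s
    using that by (simp add: topspace_uf_space principal_ultrafilter_on)
  have "beta_extension S Y f = restrict g ?X"
    unfolding beta_extension_def
  proof (rule the_equality)
    show "restrict g ?X \<in> extensional ?X \<and> continuous_map (uf_space S) Y (restrict g ?X) \<and>
      (\<forall>s\<in>S. restrict g ?X (principal_uf S s) = f s)"
      using ext uf continuous_map_eq[OF g, of "restrict g ?X"] by simp
  next
    fix h assume h: "h \<in> extensional ?X \<and> continuous_map (uf_space S) Y h \<and>
      (\<forall>s\<in>S. h (principal_uf S s) = f s)"
    show "h = restrict g ?X"
    proof (rule extensionalityI[of _ ?X])
      fix U assume "U \<in> ?X"
      hence U: "U \<in> uf_space S closure_of (principal_uf S ` S)" by (simp add: principal_ufs_dense)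
      show "h U = restrict g ?X U"
        using forall_in_closure_of_eq[OF U Y _ g, of h] h ext \<open>U \<in> ?X\<close> by fastforce
    qed (use h in auto)
  qed
  thus ?thesis using U by (simp add: topspace_uf_space)
qed

section \<open>The Vietoris hyperspace\<close>

lemma openin_vietoris_hit:
  "openin X W \<Longrightarrow> openin (vietoris X) {C. closedin X C \<and> C \<inter> W \<noteq> {}}"
  unfolding vietoris_def by (rule topology_generated_by_Basis) blast

lemma openin_vietoris_within:
  "openin X W \<Longrightarrow> openin (vietoris X) {C. closedin X C \<and> C \<subseteq> W}"
  unfolding vietoris_def by (rule topology_generated_by_Basis) blast

lemma topspace_vietoris: "topspace (vietoris X) = {C. closedin X C}"
proof
  show "topspace (vietoris X) \<subseteq> {C. closedin X C}"
    unfolding vietoris_def topology_generated_by_topspace by auto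
  show "{C. closedin X C} \<subseteq> topspace (vietoris X)"
    using openin_subset[OF openin_vietoris_within[OF openin_topspace, of X]] closedin_subset by auto
qed

text \<open>Distinct closed sets are told apart by a clopen that one meets and the other misses.
  Missing a clopen is being included in the complementary clopen, so both conditions are open in the
  hyperspace, and they exclude each other.\<close>

lemma Hausdorff_space_vietoris_uf_space: "Hausdorff_space (vietoris (uf_space S))"
proof -
  let ?X = "uf_space S"
  have sep: "\<exists>V W. openin (vietoris ?X) V \<and> openin (vietoris ?X) W \<and> C \<in> V \<and> D \<in> W \<and> disjnt V W"
    if C: "closedin ?X C" and D: "closedin ?X D" and Q: "Q \<subseteq> S"
      "C \<inter> uf_hat S Q \<noteq> {}" "D \<inter> uf_hat S Q = {}" for C D Q
  proof -
    let ?V = "{C. closedin ?X C \<and> C \<inter> uf_hat S Q \<noteq> {}}"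
    let ?W = "{C. closedin ?X C \<and> C \<subseteq> uf_hat S (S - Q)}"
    have *: "E \<subseteq> uf_hat S (S - Q) \<longleftrightarrow> E \<inter> uf_hat S Q = {}" if "closedin ?X E" for E
      using subset_uf_hat_iff[OF that, of "S - Q"] Q(1) by (simp add: double_diff)
    have "openin (vietoris ?X) ?V" "openin (vietoris ?X) ?W"
      using Q(1) by (auto intro!: openin_vietoris_hit openin_vietoris_within openin_uf_hat)
    moreover have "C \<in> ?V" "D \<in> ?W" using C D Q * by simp_all
    moreover have "disjnt ?V ?W" using * by (auto simp: disjnt_def)
    ultimately show ?thesis by blast
  qed
  show ?thesis
    unfolding Hausdorff_space_def topspace_vietoris
  proof (intro allI impI)
    fix C D assume "C \<in> {C. closedin ?X C} \<and> D \<in> {C. closedin ?X C} \<and> C \<noteq> D"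
    hence C: "closedin ?X C" and D: "closedin ?X D" and ne: "C \<noteq> D" by auto
    obtain Q where Q: "Q \<subseteq> S" "\<not> (C \<inter> uf_hat S Q \<noteq> {} \<longleftrightarrow> D \<inter> uf_hat S Q \<noteq> {})"
      using closedin_uf_space_eqI[OF C D] ne by blast
    show "\<exists>V W. openin (vietoris ?X) V \<and> openin (vietoris ?X) W \<and> C \<in> V \<and> D \<in> W \<and> disjnt V W"
    proof (cases "C \<inter> uf_hat S Q = {}")
      case True
      thus ?thesis using sep[OF D C Q(1)] Q(2) by (metis disjnt_sym)
    next
      case False
      thus ?thesis using sep[OF C D Q(1)] Q(2) by blast
    qed
  qed
qed

text \<open>It suffices to test continuity on clopens, because both kinds of subbasic open sets of
  the hyperspace are unions of those given by clopens.\<close>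

lemma continuous_map_vietoris_uf_space:
  assumes closed: "\<And>x. x \<in> topspace X \<Longrightarrow> closedin (uf_space S) (f x)"
    and hit: "\<And>Q. Q \<subseteq> S \<Longrightarrow> openin X {x \<in> topspace X. f x \<inter> uf_hat S Q \<noteq> {}}"
    and miss: "\<And>Q. Q \<subseteq> S \<Longrightarrow> openin X {x \<in> topspace X. f x \<inter> uf_hat S Q = {}}"
  shows "continuous_map X (vietoris (uf_space S)) f"
  unfolding vietoris_def
proof (rule continuous_on_generated_topo)
  have within: "openin X {x \<in> topspace X. f x \<subseteq> uf_hat S Q}" if "Q \<subseteq> S" for Q
  proof -
    have "{x \<in> topspace X. f x \<subseteq> uf_hat S Q} = {x \<in> topspace X. f x \<inter> uf_hat S (S - Q) = {}}"
      using subset_uf_hat_iff[OF closed that] by (intro Collect_cong conj_cong) simp_all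
    thus ?thesis using miss by simp
  qed
  fix B assume "B \<in> {{C. closedin (uf_space S) C \<and> C \<subseteq> U} |U. openin (uf_space S) U} \<union>
                {{C. closedin (uf_space S) C \<and> C \<inter> U \<noteq> {}} |U. openin (uf_space S) U}"
  then consider W where "openin (uf_space S) W" "B = {C. closedin (uf_space S) C \<and> C \<subseteq> W}"
    | W where "openin (uf_space S) W" "B = {C. closedin (uf_space S) C \<and> C \<inter> W \<noteq> {}}"
    by blast
  thus "openin X (f -` B \<inter> topspace X)"
  proof cases
    \<comment> \<open>Here compactness enters: a closed set inside the open set \<open>W\<close> is
      already inside a clopen that \<open>W\<close> includes.\<close>
    case (1 W)
    have "f -` B \<inter> topspace X =
        (\<Union>Q\<in>{Q. Q \<subseteq> S \<and> uf_hat S Q \<subseteq> W}. {x \<in> topspace X. f x \<subseteq> uf_hat S Q})" (is "_ = ?R")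
    proof
      show "f -` B \<inter> topspace X \<subseteq> ?R"
      proof
        fix x assume x: "x \<in> f -` B \<inter> topspace X"
        obtain Q where "Q \<subseteq> S" "f x \<subseteq> uf_hat S Q" "uf_hat S Q \<subseteq> W"
          using clopen_between_closedin_openin[of S "f x" W] x 1 by blast
        thus "x \<in> ?R" using x by blast
      qed
      show "?R \<subseteq> f -` B \<inter> topspace X" using closed 1 by blast
    qed
    thus ?thesis using within by auto
  next
    \<comment> \<open>For meeting \<open>W\<close> it is enough that the clopens form a base: a
      common point has a clopen neighbourhood inside \<open>W\<close>.\<close>
    case (2 W)
    have "f -` B \<inter> topspace X =
        (\<Union>Q\<in>{Q. Q \<subseteq> S \<and> uf_hat S Q \<subseteq> W}. {x \<in> topspace X. f x \<inter> uf_hat S Q \<noteq> {}})" (is "_ = ?R")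
    proof
      show "f -` B \<inter> topspace X \<subseteq> ?R"
      proof
        fix x assume x: "x \<in> f -` B \<inter> topspace X"
        then obtain V where "V \<in> f x" "V \<in> W" using 2 by blast
        then obtain Q where "ultrafilter_on S V" "Q \<in> V" "uf_hat S Q \<subseteq> W"
          using 2(1) unfolding openin_uf_space_iff by blast
        moreover have "Q \<subseteq> S" using calculation(1,2) by (rule ultrafilter_on_subset)
        moreover have "V \<in> f x \<inter> uf_hat S Q"
          using calculation \<open>V \<in> f x\<close> by (simp add: uf_hat_def)
        ultimately show "x \<in> ?R" using x by blast
      qed
      show "?R \<subseteq> f -` B \<inter> topspace X" using closed 2 by blast
    qed
    thus ?thesis using hit by auto
  qed
next
  show "f ` topspace X \<subseteq> \<Union> ({{C. closedin (uf_space S) C \<and> C \<subseteq> U} |U. openin (uf_space S) U} \<union>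
                {{C. closedin (uf_space S) C \<and> C \<inter> U \<noteq> {}} |U. openin (uf_space S) U})"
    unfolding topspace_vietoris[of "uf_space S", unfolded vietoris_def topology_generated_by_topspace]
    using closed by blast
qed

section \<open>Limits of families of clopens along ultrafilters\<close>

text \<open>An explicit formula for the limit, in the Vietoris hyperspace, of the clopens of the
  sets \<open>f s\<close> along \<open>U\<close>. It provides the continuous extension
  concretely.\<close>

definition uf_limit :: "'s set \<Rightarrow> 't set \<Rightarrow> ('s \<Rightarrow> 't set) \<Rightarrow> 's set set \<Rightarrow> 't set set set" where
  "uf_limit S T f U = {V. ultrafilter_on T V \<and> (\<forall>Q\<in>V. {s \<in> S. f s \<inter> Q \<noteq> {}} \<in> U)}"

text \<open>The sets met by \<open>f s\<close> for \<open>U\<close>-almost all \<open>s\<close> form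
  a grill: upward closed, without \<open>{}\<close>, and prime because \<open>U\<close> is an
  ultrafilter. An ultrafilter inside this grill that contains \<open>Q\<close> is the required
  common point.\<close>

lemma uf_limit_hits_iff:
  assumes U: "ultrafilter_on S U" and Q: "Q \<subseteq> T"
  shows "uf_limit S T f U \<inter> uf_hat T Q \<noteq> {} \<longleftrightarrow> {s \<in> S. f s \<inter> Q \<noteq> {}} \<in> U"
proof
  assume "uf_limit S T f U \<inter> uf_hat T Q \<noteq> {}"
  thus "{s \<in> S. f s \<inter> Q \<noteq> {}} \<in> U" by (auto simp: uf_limit_def uf_hat_def)
next
  let ?G = "\<lambda>P. {s \<in> S. f s \<inter> P \<noteq> {}} \<in> U"
  assume "?G Q"
  obtain V where "ultrafilter_on T V" "Q \<in> V" "\<And>P. P \<in> V \<Longrightarrow> ?G P"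
  proof (rule grill_contains_ultrafilter_on[of Q T ?G])
    show "\<not> ?G {}" using ultrafilter_on_nonempty[OF U] by simp
    fix P R
    show "?G R" if "?G P" "P \<subseteq> R"
      using that by (intro ultrafilter_on_mono[OF U that(1)]) auto
    have "{s \<in> S. f s \<inter> (P \<union> R) \<noteq> {}} = {s \<in> S. f s \<inter> P \<noteq> {}} \<union> {s \<in> S. f s \<inter> R \<noteq> {}}"
      by blast
    thus "?G P \<or> ?G R" if "?G (P \<union> R)"
      using that by (simp add: ultrafilter_on_Un_iff[OF U])
  qed (use Q \<open>?G Q\<close> in auto)
  thus "uf_limit S T f U \<inter> uf_hat T Q \<noteq> {}" by (auto simp: uf_limit_def uf_hat_def)
qed

lemma closedin_uf_limit:
  assumes U: "ultrafilter_on S U" shows "closedin (uf_space T) (uf_limit S T f U)"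
  unfolding closedin_def openin_uf_space_iff
proof (intro conjI ballI)
  show "uf_limit S T f U \<subseteq> topspace (uf_space T)"
    by (auto simp: uf_limit_def topspace_uf_space)
  fix V assume V: "V \<in> topspace (uf_space T) - uf_limit S T f U"
  then obtain Q where "Q \<in> V" "{s \<in> S. f s \<inter> Q \<noteq> {}} \<notin> U"
    by (auto simp: uf_limit_def topspace_uf_space)
  thus "\<exists>Q\<in>V. uf_hat T Q \<subseteq> topspace (uf_space T) - uf_limit S T f U"
    by (auto simp: uf_limit_def topspace_uf_space uf_hat_def)
  show "ultrafilter_on T V" using V by (simp add: topspace_uf_space)
qed

text \<open>The preimages of hitting and of missing the clopen of \<open>Q\<close> are the clopens
  of \<open>?H\<close> and of its complement.\<close>

lemma continuous_map_uf_limit: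
  "continuous_map (uf_space S) (vietoris (uf_space T)) (uf_limit S T f)"
proof (rule continuous_map_vietoris_uf_space)
  fix Q assume Q: "Q \<subseteq> T"
  let ?H = "{s \<in> S. f s \<inter> Q \<noteq> {}}"
  have "{U \<in> topspace (uf_space S). uf_limit S T f U \<inter> uf_hat T Q \<noteq> {}} = uf_hat S ?H"
    using uf_limit_hits_iff[OF _ Q, of S _ f] unfolding topspace_uf_space uf_hat_def[of S] by blast
  thus "openin (uf_space S) {U \<in> topspace (uf_space S). uf_limit S T f U \<inter> uf_hat T Q \<noteq> {}}"
    using openin_uf_hat[of ?H S] by simp
  have "{U \<in> topspace (uf_space S). uf_limit S T f U \<inter> uf_hat T Q = {}} = uf_hat S (S - ?H)"
    using uf_limit_hits_iff[OF _ Q, of S _ f] ultrafilter_on_Compl_iff[of S _ ?H]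
    unfolding topspace_uf_space uf_hat_def[of S] by blast
  thus "openin (uf_space S) {U \<in> topspace (uf_space S). uf_limit S T f U \<inter> uf_hat T Q = {}}"
    using openin_uf_hat[of "S - ?H" S] by simp
qed (simp add: topspace_uf_space closedin_uf_limit)

lemma uf_hat_hits_iff:
  assumes "P \<subseteq> T" "Q \<subseteq> T" shows "uf_hat T P \<inter> uf_hat T Q \<noteq> {} \<longleftrightarrow> P \<inter> Q \<noteq> {}"
proof
  assume "uf_hat T P \<inter> uf_hat T Q \<noteq> {}"
  then obtain V where V: "ultrafilter_on T V" "P \<in> V" "Q \<in> V" by (auto simp: uf_hat_def)
  from ultrafilter_on_Int[OF this] ultrafilter_on_nonempty[OF V(1)] show "P \<inter> Q \<noteq> {}" by auto
next
  assume "P \<inter> Q \<noteq> {}"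
  then obtain t where "t \<in> P" "t \<in> Q" by blast
  hence "principal_uf T t \<in> uf_hat T P \<inter> uf_hat T Q"
    using assms principal_ultrafilter_on[of t T] by (auto simp: uf_hat_def principal_uf_def)
  thus "uf_hat T P \<inter> uf_hat T Q \<noteq> {}" by blast
qed

text \<open>Along a principal ultrafilter, almost all \<open>s\<close> means the one generating
  point, so both closed sets meet the same clopens.\<close>

lemma uf_limit_principal:
  assumes "s \<in> S" "f s \<subseteq> T"
  shows "uf_limit S T f (principal_uf S s) = uf_hat T (f s)"
proof (rule closedin_uf_space_eqI)
  have U: "ultrafilter_on S (principal_uf S s)" using assms by (simp add: principal_ultrafilter_on)
  thus "closedin (uf_space T) (uf_limit S T f (principal_uf S s))" by (rule closedin_uf_limit)
  show "closedin (uf_space T) (uf_hat T (f s))" using assms by (simp add: closedin_uf_hat)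
  fix Q assume "Q \<subseteq> T"
  thus "uf_limit S T f (principal_uf S s) \<inter> uf_hat T Q \<noteq> {} \<longleftrightarrow> uf_hat T (f s) \<inter> uf_hat T Q \<noteq> {}"
    using assms uf_limit_hits_iff[OF U, of Q T f] uf_hat_hits_iff[of "f s" T Q]
    by (simp add: principal_uf_def)
qed

section \<open>Points of the dual space\<close>

text \<open>The tuple of limits is continuous in each coordinate and agrees with
  \<open>ck_word\<close> on principal ultrafilters, so by uniqueness it is the extension.\<close>

lemma ck_eq_uf_limit:
  assumes "ultrafilter_on (lists A) U"
  shows "ck A k U = (\<lambda>a\<in>tuples A k. uf_limit (lists A) (Nk k) (occ k a) U)"
  unfolding ck_def
proof (rule beta_extension_eqI[OF _ _ _ assms])
  show "Hausdorff_space (Vk A k)"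
    unfolding Vk_def Hausdorff_space_product_topology
    by (simp add: Hausdorff_space_vietoris_uf_space)
  show "continuous_map (uf_space (lists A)) (Vk A k)
          (\<lambda>U. \<lambda>a\<in>tuples A k. uf_limit (lists A) (Nk k) (occ k a) U)"
    unfolding Vk_def continuous_map_componentwise
    by (auto intro: continuous_map_uf_limit)
  fix w assume "w \<in> lists A"
  thus "(\<lambda>a\<in>tuples A k. uf_limit (lists A) (Nk k) (occ k a) (principal_uf (lists A) w)) =
          ck_word A k w"
    unfolding ck_word_def
    by (intro restrict_ext uf_limit_principal) (auto simp: occ_def)
qed

text \<open>For each \<open>U\<close> the inner condition is equivalent to
  \<open>C = ck A k U\<close>: the clopens met by the coordinates of \<open>ck A k U\<close> are
  known from \<open>uf_limit_hits_iff\<close>, and they determine these coordinates.\<close>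

lemma Xk_iff_ultrafilter:
  assumes C: "C \<in> topspace (Vk A k)"
  shows "C \<in> Xk A k \<longleftrightarrow> (\<exists>U. ultrafilter_on (lists A) U \<and> (\<forall>a\<in>tuples A k. \<forall>Q\<subseteq>Nk k.
           {w \<in> lists A. occ k a w \<inter> Q \<noteq> {}} \<in> U \<longleftrightarrow> C a \<inter> uf_hat (Nk k) Q \<noteq> {}))"
proof -
  \<comment> \<open>Points of the product are \<open>extensional\<close>, so equality with the
    restricted tuple of limits need only be checked on \<open>tuples A k\<close>.\<close>
  have C': "C \<in> extensional (tuples A k)" "\<And>a. a \<in> tuples A k \<Longrightarrow> closedin (uf_space (Nk k)) (C a)"
    using C by (auto simp: Vk_def topspace_vietoris PiE_def)
  have "C = ck A k U \<longleftrightarrow> (\<forall>a\<in>tuples A k. \<forall>Q\<subseteq>Nk k.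
      {w \<in> lists A. occ k a w \<inter> Q \<noteq> {}} \<in> U \<longleftrightarrow> C a \<inter> uf_hat (Nk k) Q \<noteq> {})" (is "_ \<longleftrightarrow> ?R")
    if U: "ultrafilter_on (lists A) U" for U
  proof
    assume "C = ck A k U"
    thus ?R using U by (simp add: ck_eq_uf_limit uf_limit_hits_iff)
  next
    assume R: ?R
    show "C = ck A k U"
      unfolding ck_eq_uf_limit[OF U]
    proof (rule extensionalityI[OF C'(1) restrict_extensional])
      fix a assume a: "a \<in> tuples A k"
      have "C a = uf_limit (lists A) (Nk k) (occ k a) U"
        by (rule closedin_uf_space_eqI[OF C'(2)[OF a] closedin_uf_limit[OF U]])
          (use R a in \<open>simp add: uf_limit_hits_iff[OF U]\<close>)
      thus "C a = (\<lambda>a\<in>tuples A k. uf_limit (lists A) (Nk k) (occ k a) U) a" using a by simp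
    qed
  qed
  thus ?thesis unfolding Xk_def topspace_uf_space image_iff by auto
qed

text \<open>An ultrafilter containing a finite union contains one of its parts, so the clopen of a
  union of finitely many colour classes is the union of their clopens. The finiteness of
  \<open>I\<close> is essential for this.\<close>

lemma same_profile_imp_hits_iff:
  assumes "finite_colouring k I q" "point_profile A k I C q = word_profile A k I w q"
    and "J \<subseteq> I" and a: "a \<in> tuples A k"
  shows "C a \<inter> uf_hat (Nk k) (\<Union>i\<in>J. colour_class k q i) \<noteq> {} \<longleftrightarrow>
         occ k a w \<inter> (\<Union>i\<in>J. colour_class k q i) \<noteq> {}"
proof -
  have J: "finite J" using assms by (auto simp: finite_colouring_def finite_subset)
  have "point_pairing A k C (colour_class k q i) = word_pairing A k w (colour_class k q i)"
    if "i \<in> J" for i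
    using fun_cong[OF assms(2), of i] that \<open>J \<subseteq> I\<close>
    by (auto simp: point_profile_def word_profile_def)
  hence hits: "C a \<inter> uf_hat (Nk k) (colour_class k q i) \<noteq> {} \<longleftrightarrow> occ k a w \<inter> colour_class k q i \<noteq> {}"
    if "i \<in> J" for i
    using a that unfolding point_pairing_def word_pairing_def by blast
  have hat: "uf_hat (Nk k) (\<Union>i\<in>J. colour_class k q i) =
      (\<Union>i\<in>J. uf_hat (Nk k) (colour_class k q i))"
  proof -
    have "colour_class k q i \<subseteq> Nk k" for i by (auto simp: colour_class_def)
    hence "(\<Union>i\<in>J. colour_class k q i) \<in> V \<longleftrightarrow> (\<exists>i\<in>J. colour_class k q i \<in> V)"
      if "ultrafilter_on (Nk k) V" for V
      using ultrafilter_on_UN_iff[OF that J] by simp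
    thus ?thesis by (auto simp: uf_hat_def)
  qed
  have "C a \<inter> (\<Union>i\<in>J. uf_hat (Nk k) (colour_class k q i)) \<noteq> {} \<longleftrightarrow>
      (\<exists>i\<in>J. C a \<inter> uf_hat (Nk k) (colour_class k q i) \<noteq> {})" by blast
  also have "\<dots> \<longleftrightarrow> (\<exists>i\<in>J. occ k a w \<inter> colour_class k q i \<noteq> {})" using hits by simp
  also have "\<dots> \<longleftrightarrow> occ k a w \<inter> (\<Union>i\<in>J. colour_class k q i) \<noteq> {}" by blast
  finally show ?thesis unfolding hat .
qed

text \<open>A point is coloured by the set of those members of \<open>\<Q>\<close> that contain it,
  so the colour classes are the atoms of the generated Boolean algebra and possibly empty sets. The
  injection \<open>e\<close> only turns these colours into natural numbers.\<close>

lemma finite_colouring_refining: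
  assumes "finite \<Q>"
  shows "\<exists>I q. finite_colouring k I q \<and>
    (\<forall>Q\<in>\<Q>. Q \<subseteq> Nk k \<longrightarrow> (\<exists>J\<subseteq>I. Q = (\<Union>i\<in>J. colour_class k q i)))"
proof -
  have "finite (Pow \<Q>)" using assms by simp
  then obtain e :: "nat list set set \<Rightarrow> nat" where e: "inj_on e (Pow \<Q>)"
    using finite_imp_inj_to_nat_seg[of "Pow \<Q>"] by metis
  define q where "q x = e {Q \<in> \<Q>. x \<in> Q}" for x
  show ?thesis
  proof (rule exI, rule exI, intro conjI ballI impI)
    show "finite_colouring k (e ` Pow \<Q>) q"
      using assms by (auto simp: finite_colouring_def q_def)
    fix Q assume Q: "Q \<in> \<Q>" "Q \<subseteq> Nk k"
    have "x \<in> Q" if "q x = q y" "y \<in> Q" for x y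
    proof -
      have "{Q \<in> \<Q>. x \<in> Q} = {Q \<in> \<Q>. y \<in> Q}"
        using that(1) by (intro inj_onD[OF e]) (auto simp: q_def)
      thus ?thesis using Q(1) that(2) by blast
    qed
    \<comment> \<open>Points of equal colour lie in the same members of \<open>\<Q>\<close>, so the
      colours occurring on \<open>Q\<close> occur nowhere outside it.\<close>
    hence "Q = (\<Union>i\<in>q ` Q. colour_class k q i)"
      using Q(2) by (auto simp: colour_class_def)
    moreover have "q ` Q \<subseteq> e ` Pow \<Q>" by (auto simp: q_def)
    ultimately show "\<exists>J\<subseteq>e ` Pow \<Q>. Q = (\<Union>i\<in>J. colour_class k q i)" by blast
  qed
qed

lemma finite_tuples: "finite A \<Longrightarrow> finite (tuples A k)"
  using finite_lists_length_eq[of A k] by (simp add: tuples_def lists_eq_set)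

text \<open>A profile consists of finitely many yes-or-no conditions, one for each tuple and colour.
  The language of words agreeing with \<open>C\<close> on one condition lies in \<open>U\<close>; so
  does the intersection of these languages, and any word in it has the profile of
  \<open>C\<close>.\<close>

lemma Xk_imp_profile:
  assumes A: "finite A" and C: "C \<in> topspace (Vk A k)" "C \<in> Xk A k"
    and q: "finite_colouring k I q"
  obtains w where "w \<in> lists A" "point_profile A k I C q = word_profile A k I w q"
proof -
  define L where "L a Q = {w \<in> lists A. occ k a w \<inter> Q \<noteq> {}}" for a Q
  define E where "E = (\<lambda>(a, i). {w \<in> lists A.
    occ k a w \<inter> colour_class k q i \<noteq> {} \<longleftrightarrow> C a \<inter> uf_hat (Nk k) (colour_class k q i) \<noteq> {}})"
  obtain U where U: "ultrafilter_on (lists A) U"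
    and hits: "\<And>a Q. a \<in> tuples A k \<Longrightarrow> Q \<subseteq> Nk k \<Longrightarrow> L a Q \<in> U \<longleftrightarrow> C a \<inter> uf_hat (Nk k) Q \<noteq> {}"
    using C Xk_iff_ultrafilter[OF C(1)] unfolding L_def by blast
  have E: "E p \<in> U" if "p \<in> tuples A k \<times> I" for p
  proof -
    obtain a i where p: "p = (a, i)" "a \<in> tuples A k" using \<open>p \<in> _\<close> by blast
    let ?Q = "colour_class k q i"
    have Q: "?Q \<subseteq> Nk k" by (auto simp: colour_class_def)
    show ?thesis
    proof (cases "C a \<inter> uf_hat (Nk k) ?Q = {}")
      case True
      have "L a ?Q \<subseteq> lists A" by (auto simp: L_def)
      with True have "lists A - L a ?Q \<in> U"
        using hits[OF p(2) Q] by (simp add: ultrafilter_on_Compl_iff[OF U])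
      moreover have "E p = lists A - L a ?Q" using True by (auto simp: E_def p(1) L_def)
      ultimately show ?thesis by simp
    next
      case False
      hence "E p = L a ?Q" by (auto simp: E_def p(1) L_def)
      thus ?thesis using hits[OF p(2) Q] False by simp
    qed
  qed
  have "finite (tuples A k \<times> I)" using A q by (simp add: finite_tuples finite_colouring_def)
  hence mem: "lists A \<inter> (\<Inter>p\<in>tuples A k \<times> I. E p) \<in> U" by (rule ultrafilter_on_INT[OF U _ E])
  have "lists A \<inter> (\<Inter>p\<in>tuples A k \<times> I. E p) \<noteq> {}"
    by (rule notI) (use mem ultrafilter_on_nonempty[OF U] in \<open>simp only:\<close>)
  then obtain w where w: "w \<in> lists A" "\<And>p. p \<in> tuples A k \<times> I \<Longrightarrow> w \<in> E p" by blast
  have "occ k a w \<inter> colour_class k q i \<noteq> {} \<longleftrightarrow>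
      C a \<inter> uf_hat (Nk k) (colour_class k q i) \<noteq> {}" if "a \<in> tuples A k" "i \<in> I" for a i
    using w(2)[of "(a, i)"] that by (simp add: E_def)
  hence "point_pairing A k C (colour_class k q i) = word_pairing A k w (colour_class k q i)"
    if "i \<in> I" for i
    using that unfolding point_pairing_def word_pairing_def by (intro Collect_cong conj_cong) simp_all
  hence "point_profile A k I C q = word_profile A k I w q"
    unfolding point_profile_def word_profile_def by (rule restrict_ext)
  thus thesis using w(1) that by blast
qed

text \<open>The languages \<open>E (a, Q)\<close> of words agreeing with \<open>C\<close> about
  \<open>(a, Q)\<close> have the finite intersection property, because a word with the right profile
  for a refining colouring lies in any given finite number of them. An ultrafilter containing them
  all represents \<open>C\<close>.\<close>

lemma profiles_imp_Xk:
  assumes C: "C \<in> topspace (Vk A k)"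
    and prof: "\<And>I q. finite_colouring k I q \<Longrightarrow>
      \<exists>w\<in>lists A. point_profile A k I C q = word_profile A k I w q"
  shows "C \<in> Xk A k"
proof -
  define E where "E = (\<lambda>(a, Q). {w \<in> lists A.
    occ k a w \<inter> Q \<noteq> {} \<longleftrightarrow> C a \<inter> uf_hat (Nk k) Q \<noteq> {}})"
  let ?D = "tuples A k \<times> Pow (Nk k)"
  obtain U where U: "ultrafilter_on (lists A) U" "E ` ?D \<subseteq> U"
  proof (rule fip_extends_to_ultrafilter_on)
    have "E p \<subseteq> lists A" for p by (simp add: E_def split: prod.split)
    thus "E ` ?D \<subseteq> Pow (lists A)" by blast
    fix G assume "finite G" "G \<subseteq> E ` ?D"
    then obtain D where D: "D \<subseteq> ?D" "finite D" "G = E ` D" by (meson finite_subset_image)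
    \<comment> \<open>Only the sets \<open>Q\<close> of the finitely many pairs need refining, since
      a profile records every tuple \<open>a\<close> at once.\<close>
    obtain I q where q: "finite_colouring k I q"
      and J: "\<forall>Q\<in>snd ` D. Q \<subseteq> Nk k \<longrightarrow> (\<exists>J\<subseteq>I. Q = (\<Union>i\<in>J. colour_class k q i))"
      using finite_colouring_refining[OF finite_imageI[OF D(2), of snd], of k] by metis
    obtain w where w: "w \<in> lists A" "point_profile A k I C q = word_profile A k I w q"
      using prof[OF q] by blast
    have "w \<in> E p" if p: "p \<in> D" for p
    proof -
      obtain a Q where aQ: "p = (a, Q)" "a \<in> tuples A k" "Q \<subseteq> Nk k" using p D(1) by blast
      have "Q \<in> snd ` D" using p aQ(1) by force
      with J aQ(3) obtain J where J: "J \<subseteq> I" "Q = (\<Union>i\<in>J. colour_class k q i)" by metis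
      show ?thesis
        using same_profile_imp_hits_iff[OF q w(2) J(1) aQ(2)] w(1) J(2) by (simp add: E_def aQ(1))
    qed
    thus "lists A \<inter> \<Inter>G \<noteq> {}" using w(1) D(3) by blast
  qed
  \<comment> \<open>\<open>E (a, Q)\<close> is the language on the left or its complement in
    \<open>lists A\<close>, according to whether \<open>C a\<close> meets the clopen of
    \<open>Q\<close>; its membership in \<open>U\<close> therefore settles the equivalence in both
    cases.\<close>
  have "{w \<in> lists A. occ k a w \<inter> Q \<noteq> {}} \<in> U \<longleftrightarrow> C a \<inter> uf_hat (Nk k) Q \<noteq> {}"
    if "a \<in> tuples A k" "Q \<subseteq> Nk k" for a Q
  proof -
    let ?L = "{w \<in> lists A. occ k a w \<inter> Q \<noteq> {}}"
    have EU: "E (a, Q) \<in> U" using U(2) that by blast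
    show ?thesis
    proof (cases "C a \<inter> uf_hat (Nk k) Q = {}")
      case True
      hence "E (a, Q) = lists A - ?L" by (auto simp: E_def)
      thus ?thesis using EU True ultrafilter_on_Compl_iff[OF U(1), of ?L] by auto
    next
      case False
      hence "E (a, Q) = ?L" by (auto simp: E_def)
      thus ?thesis using EU False by simp
    qed
  qed
  thus ?thesis using U(1) Xk_iff_ultrafilter[OF C] by blast
qed

theorem mainTheorem5:
  fixes A :: "'a set" and k :: nat
    and C :: "'a list \<Rightarrow> nat list set set set"
  assumes "finite A" and "k \<ge> 1" and "C \<in> topspace (Vk A k)"
  shows "(C \<in> Xk A k \<longleftrightarrow>
           (\<forall>I q. finite_colouring k I q \<longrightarrow>
              (\<exists>w\<in>lists A. point_profile A k I C q = word_profile A k I w q))) \<and>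
         (C \<in> Xk A k \<longrightarrow>
           (\<forall>I q. finite_colouring k I q \<longrightarrow>
              (\<forall>w\<in>lists A. point_profile A k I C q = word_profile A k I w q \<longrightarrow>
                 (\<forall>J\<subseteq>I. \<forall>Q. Q = (\<Union>i\<in>J. colour_class k q i) \<longrightarrow>
                    (\<forall>a\<in>tuples A k.
                       C a \<inter> uf_hat (Nk k) Q \<noteq> {} \<longleftrightarrow> occ k a w \<inter> Q \<noteq> {})))))"
proof (intro conjI allI impI ballI)
  show "C \<in> Xk A k \<longleftrightarrow> (\<forall>I q. finite_colouring k I q \<longrightarrow>
      (\<exists>w\<in>lists A. point_profile A k I C q = word_profile A k I w q))"
    using Xk_imp_profile[OF assms(1,3)] profiles_imp_Xk[OF assms(3)] by metis
next
  fix I q w J Q a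
  assume "finite_colouring k I q" "point_profile A k I C q = word_profile A k I w q" "J \<subseteq> I"
    and "Q = (\<Union>i\<in>J. colour_class k q i)" "a \<in> tuples A k"
  thus "C a \<inter> uf_hat (Nk k) Q \<noteq> {} \<longleftrightarrow> occ k a w \<inter> Q \<noteq> {}"
    using same_profile_imp_hits_iff by metis
qed

end
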